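(* The following conditions are equivalent for a connected quandle $Q$: (i) $Q$ is affine. (ii) $Q$ is medial. (iii) The derived subgroup $\mathrm{RMlt}(Q)'$ is abelian. (iv) There is an abelian group $A=(Q,+)$ on the underlying set of $Q$ such that $\mathrm{Mlt}(A)\le\mathrm{RMlt}(Q)\le\mathrm{Aff}(A)$.
   Context: Mappings are applied on the right, as superscripts. A quandle is a set $Q$ with a binary operation (written as juxtaposition) such that for every $x\in Q$ the right translation $R_x:Q\to Q$, $y\mapsto yx$, is an automorphism of $Q$, and $xx=x$ for all $x\in Q$. $\mathrm{RMlt}(Q)=\langle R_x:x\in Q\rangle\le\mathrm{Aut}(Q)$; $Q$ is connected if $\mathrm{RMlt}(Q)$ acts transitively on $Q$. A quandle is medial if $(xy)(uv)=(xu)(yv)$ for all $x,y,u,v$. For an abelian group $A=(A,+)$ and $f\in\mathrm{Aut}(A)$, the quandle $\mathcal Q_{\mathrm{Aff}}(A,f)=(A,* )$ has operation $x*y=x^f+y^{1-f}$, where $y^{1-f}=y-y^f$. A quandle is affine if it is (isomorphic to) a quandle of the form $\mathcal Q_{\mathrm{Aff}}(A,f)$. For an abelian group $A$, $\mathrm{Mlt}(A)=\{x\mapsto c+x : c\in A\}$ is the group of translations and $\mathrm{Aff}(A)=\{x\mapsto c+x^f : c\in A,\ f\in\mathrm{Aut}(A)\}$ is the group of affine mappings, both subgroups of the symmetric group on $A$. *)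

theory Defs
  imports "HOL-Algebra.Algebra"
begin

definition magma_iso ::
  "'a set \<Rightarrow> ('a \<Rightarrow> 'a \<Rightarrow> 'a) \<Rightarrow> 'b set \<Rightarrow> ('b \<Rightarrow> 'b \<Rightarrow> 'b) \<Rightarrow> ('a \<Rightarrow> 'b) set" where
  "magma_iso Q m Q' m' =
     {h. bij_betw h Q Q' \<and> (\<forall>x\<in>Q. \<forall>y\<in>Q. h (m x y) = m' (h x) (h y))}"

text \<open>As in \<^const>\<open>Bij\<close> and \<^const>\<open>auto\<close>, automorphisms are extensional functions, so that
  each automorphism is represented by exactly one function.\<close>

definition magma_auto :: "'a set \<Rightarrow> ('a \<Rightarrow> 'a \<Rightarrow> 'a) \<Rightarrow> ('a \<Rightarrow> 'a) set" where
  "magma_auto Q m = magma_iso Q m Q m \<inter> Bij Q"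

definition right_translation :: "'a set \<Rightarrow> ('a \<Rightarrow> 'a \<Rightarrow> 'a) \<Rightarrow> 'a \<Rightarrow> 'a \<Rightarrow> 'a" where
  "right_translation Q m x = (\<lambda>y\<in>Q. m y x)"

text \<open>As usual for algebraic structures, the underlying set is nonempty. (The empty set with its
  unique operation would be medial but not affine.)\<close>

definition quandle :: "'a set \<Rightarrow> ('a \<Rightarrow> 'a \<Rightarrow> 'a) \<Rightarrow> bool" where
  "quandle Q m \<longleftrightarrow>
     Q \<noteq> {} \<and>
     (\<forall>x\<in>Q. \<forall>y\<in>Q. m x y \<in> Q) \<and>
     (\<forall>x\<in>Q. right_translation Q m x \<in> magma_auto Q m) \<and>
     (\<forall>x\<in>Q. m x x = x)"

text \<open>In \<^const>\<open>BijGroup\<close> the product of \<open>g\<close> and \<open>f\<close> means first \<open>f\<close>, then \<open>g\<close>, which is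
  opposite to the product of mappings acting on the right. A group and its opposite have the same
  subgroups, generated subgroups and derived subgroups as sets, so the notions below are unaffected.\<close>

definition RMlt :: "'a set \<Rightarrow> ('a \<Rightarrow> 'a \<Rightarrow> 'a) \<Rightarrow> ('a \<Rightarrow> 'a) set" where
  "RMlt Q m = generate (BijGroup Q) (right_translation Q m ` Q)"

definition connected_quandle :: "'a set \<Rightarrow> ('a \<Rightarrow> 'a \<Rightarrow> 'a) \<Rightarrow> bool" where
  "connected_quandle Q m \<longleftrightarrow>
     quandle Q m \<and> transitive_action (BijGroup Q\<lparr>carrier := RMlt Q m\<rparr>) Q (\<lambda>g. g)"

definition medial :: "'a set \<Rightarrow> ('a \<Rightarrow> 'a \<Rightarrow> 'a) \<Rightarrow> bool" where
  "medial Q m \<longleftrightarrow>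
     (\<forall>x\<in>Q. \<forall>y\<in>Q. \<forall>u\<in>Q. \<forall>v\<in>Q. m (m x y) (m u v) = m (m x u) (m y v))"

text \<open>Abelian groups are written multiplicatively, as in \<open>HOL-Algebra\<close>.\<close>

definition aff_op :: "'a monoid \<Rightarrow> ('a \<Rightarrow> 'a) \<Rightarrow> 'a \<Rightarrow> 'a \<Rightarrow> 'a" where
  "aff_op A f x y = f x \<otimes>\<^bsub>A\<^esub> (y \<otimes>\<^bsub>A\<^esub> inv\<^bsub>A\<^esub> (f y))"

text \<open>The abelian group is sought in the element type of the quandle. This is no restriction, see
  \<open>affine_quandleI\<close> below.\<close>

definition affine_quandle :: "'a set \<Rightarrow> ('a \<Rightarrow> 'a \<Rightarrow> 'a) \<Rightarrow> bool" where
  "affine_quandle Q m \<longleftrightarrow>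
     (\<exists>(A :: 'a monoid) f h. comm_group A \<and> f \<in> auto A \<and>
        h \<in> magma_iso (carrier A) (aff_op A f) Q m)"

definition Mlt_grp :: "'a monoid \<Rightarrow> ('a \<Rightarrow> 'a) set" where
  "Mlt_grp A = {\<lambda>x\<in>carrier A. c \<otimes>\<^bsub>A\<^esub> x | c. c \<in> carrier A}"

definition Aff_grp :: "'a monoid \<Rightarrow> ('a \<Rightarrow> 'a) set" where
  "Aff_grp A = {\<lambda>x\<in>carrier A. c \<otimes>\<^bsub>A\<^esub> f x | c f. c \<in> carrier A \<and> f \<in> auto A}"

lemma affine_quandleI:
  fixes A :: "'b monoid" and Q :: "'a set"
  assumes A: "comm_group A" and f: "f \<in> auto A"
    and h: "h \<in> magma_iso (carrier A) (aff_op A f) Q m"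
  shows "affine_quandle Q m"
proof -
  interpret A: comm_group A by fact
  define k where "k = inv_into (carrier A) h"
  have bij: "bij_betw h (carrier A) Q"
    and hom: "\<And>x y. x \<in> carrier A \<Longrightarrow> y \<in> carrier A \<Longrightarrow> h (aff_op A f x y) = m (h x) (h y)"
    using h by (auto simp: magma_iso_def)
  have kQ: "k u \<in> carrier A" "h (k u) = u" if "u \<in> Q" for u
    using bij that unfolding k_def
    by (auto simp: bij_betw_def inv_into_into f_inv_into_f)
  have hA: "h x \<in> Q" "k (h x) = x" if "x \<in> carrier A" for x
    using bij that unfolding k_def by (auto simp: bij_betw_def)
  have fA: "f x \<in> carrier A" if "x \<in> carrier A" for x
    using f that by (auto simp: auto_def hom_def)
  have f_mult: "f (x \<otimes>\<^bsub>A\<^esub> y) = f x \<otimes>\<^bsub>A\<^esub> f y"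
    if "x \<in> carrier A" "y \<in> carrier A" for x y
    using f that by (auto simp: auto_def hom_def)
  define B where "B = \<lparr>carrier = Q, monoid.mult = (\<lambda>u v. h (k u \<otimes>\<^bsub>A\<^esub> k v)), one = h \<one>\<^bsub>A\<^esub>\<rparr>"
  have car: "carrier B = Q" and mult: "\<And>u v. u \<otimes>\<^bsub>B\<^esub> v = h (k u \<otimes>\<^bsub>A\<^esub> k v)"
    and one: "\<one>\<^bsub>B\<^esub> = h \<one>\<^bsub>A\<^esub>"
    by (auto simp: B_def)
  have B: "comm_group B"
  proof (rule comm_groupI)
    fix x assume "x \<in> carrier B"
    then have "h (inv\<^bsub>A\<^esub> (k x)) \<in> carrier B \<and> h (inv\<^bsub>A\<^esub> (k x)) \<otimes>\<^bsub>B\<^esub> x = \<one>\<^bsub>B\<^esub>"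
      by (simp add: car mult one hA kQ)
    then show "\<exists>y\<in>carrier B. y \<otimes>\<^bsub>B\<^esub> x = \<one>\<^bsub>B\<^esub>" by blast
  qed (auto simp: car mult one hA kQ A.m_ac)
  interpret B: comm_group B by fact
  have inv: "inv\<^bsub>B\<^esub> u = h (inv\<^bsub>A\<^esub> (k u))" if "u \<in> Q" for u
    by (rule B.inv_equality) (use that in \<open>auto simp: car mult one hA kQ\<close>)
  define g where "g = (\<lambda>u\<in>Q. h (f (k u)))"
  have bij_f: "bij_betw f (carrier A) (carrier A)"
    using f by (auto simp: auto_def Bij_def)
  have bij_k: "bij_betw k Q (carrier A)"
    unfolding k_def by (rule bij_betw_inv_into[OF bij])
  have "bij_betw (h \<circ> (f \<circ> k)) Q Q"
    by (rule bij_betw_trans[OF bij_betw_trans[OF bij_k bij_f] bij])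
  then have "bij_betw g Q Q"
    by (subst bij_betw_cong[where g = "h \<circ> (f \<circ> k)"]) (auto simp: g_def)
  moreover have "g \<in> hom B B"
    by (auto simp: hom_def car mult g_def hA kQ fA f_mult)
  ultimately have g: "g \<in> auto B"
    by (auto simp: auto_def Bij_def car g_def)
  have "aff_op B g u v = m u v" if "u \<in> Q" "v \<in> Q" for u v
  proof -
    have "aff_op B g u v = h (aff_op A f (k u) (k v))"
      using that by (simp add: aff_op_def g_def mult inv hA kQ fA)
    then show ?thesis using that by (simp add: hom kQ)
  qed
  then have "(\<lambda>x. x) \<in> magma_iso (carrier B) (aff_op B g) Q m"
    by (auto simp: magma_iso_def car bij_betw_def)
  with B g show ?thesis
    unfolding affine_quandle_def by blast
qed

end

theory Submission
  imports Defs
begin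

text \<open>The implications are proved cyclically. Conjugating \<open>R\<^sub>x\<close> by an automorphism \<open>g\<close> gives
  \<open>R\<^bsub>g x\<^esub>\<close>, so \<open>RMlt(Q)\<close> is generated by a conjugation-closed set and its derived subgroup is
  contained in the subgroup generated by the quotients \<open>R\<^sub>x R\<^sub>y\<^sup>-\<^sup>1\<close>; mediality makes these quotients
  commute. Conversely, for connected \<open>Q\<close> the derived subgroup is transitive, since \<open>R\<^sub>e\<close> fixes \<open>e\<close>
  and all \<open>R\<^sub>x\<close> are congruent to \<open>R\<^sub>e\<close> modulo it. If it is abelian, it is therefore regular, and its
  group structure transported to \<open>Q\<close> along \<open>d \<mapsto> d e\<close> is the required abelian group. Finally, if
  the translations of \<open>A\<close> are automorphisms of \<open>Q\<close>, then all \<open>R\<^sub>c\<close> are translation conjugates of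
  \<open>R\<^sub>0\<close>, which is an affine map fixing \<open>0\<close>.\<close>

section \<open>Subgroups generated by conjugation-closed or commuting sets\<close>

text \<open>Once \<open>m_assoc\<close> has bracketed a product to the right, an element and its
  inverse may meet in the middle of it; these rules cancel such pairs.\<close>

lemma (in group) inv_mult_cancel:
  assumes "x \<in> carrier G" "y \<in> carrier G"
  shows "inv x \<otimes> (x \<otimes> y) = y" "x \<otimes> (inv x \<otimes> y) = y"
  using assms by (simp_all add: m_assoc[symmetric])

text \<open>A centralizer argument: the elements commuting with a fixed \<open>b\<close> are closed
  under products and inverses, so commuting with \<open>S\<close> extends to all of
  \<open>generate G S\<close>. This is used once in each argument.\<close>

lemma (in group) generate_commute:
  assumes S: "S \<subseteq> carrier G"
    and comm: "\<And>x y. x \<in> S \<Longrightarrow> y \<in> S \<Longrightarrow> x \<otimes> y = y \<otimes> x"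
    and x: "x \<in> generate G S" and y: "y \<in> generate G S"
  shows "x \<otimes> y = y \<otimes> x"
proof -
  have inv_comm: "inv a \<otimes> b = b \<otimes> inv a"
    if "a \<in> carrier G" "b \<in> carrier G" "a \<otimes> b = b \<otimes> a" for a b
  proof -
    have "b = inv a \<otimes> (b \<otimes> a)"
      using that by (metis inv_solve_left m_closed)
    then show ?thesis
      using that by (metis inv_closed inv_solve_right m_assoc m_closed)
  qed
  have one_side: "a \<otimes> b = b \<otimes> a"
    if "b \<in> carrier G" "\<And>s. s \<in> S \<Longrightarrow> s \<otimes> b = b \<otimes> s" "a \<in> generate G S" for a b
    using that(3)
  proof (induction rule: generate.induct)
    case (inv h)
    then show ?case using that S inv_comm by blast
  next
    case (eng h1 h2)
    then have "h1 \<in> carrier G" "h2 \<in> carrier G"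
      using generate_in_carrier[OF S] by auto
    with eng that(1) show ?case by (metis m_assoc)
  qed (use that in auto)
  have yG: "y \<in> carrier G" using generate_in_carrier[OF S y] .
  show ?thesis
  proof (rule one_side[OF yG _ x])
    fix s assume s: "s \<in> S"
    \<comment> \<open>Here the generator \<open>s\<close> is the fixed element and \<open>y\<close>
      runs over the generated subgroup; the outer use of \<open>one_side\<close> then fixes
      \<open>y\<close>.\<close>
    then show "s \<otimes> y = y \<otimes> s"
      using one_side[of s y] comm S y by (metis subsetD)
  qed
qed

text \<open>Conjugation permutes the quotients of elements of \<open>S\<close>, so they generate a
  subgroup normalized by \<open>generate G S\<close>; modulo it all generators coincide, hence
  commutators vanish.\<close>

lemma (in group) derived_generate_subset:
  assumes S: "S \<subseteq> carrier G"
    and conj: "\<And>g s. g \<in> generate G S \<Longrightarrow> s \<in> S \<Longrightarrow> g \<otimes> s \<otimes> inv g \<in> S"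
  shows "derived G (generate G S) \<subseteq> generate G {x \<otimes> inv y | x y. x \<in> S \<and> y \<in> S}"
    (is "_ \<subseteq> generate G ?U")
proof -
  let ?H = "generate G S" and ?T = "generate G ?U"
  have HG: "h \<in> carrier G" if "h \<in> ?H" for h using generate_in_carrier[OF S that] .
  have U: "?U \<subseteq> carrier G" using S by auto
  have T: "subgroup ?T G" using generate_is_subgroup[OF U] .
  have UH: "?U \<subseteq> ?H"
    using generate.incl[of _ S G] generate.inv[of _ S G] by (auto intro: generate.eng)
  have H: "subgroup ?H G" using generate_is_subgroup[OF S] .
  \<comment> \<open>Normality is stated inside the group on \<open>?H\<close>, because
    \<open>S\<close> is closed only under conjugation by elements of \<open>?H\<close>, not of
    \<open>G\<close>.\<close>
  have "generate (G\<lparr>carrier := ?H\<rparr>) ?U \<lhd> G\<lparr>carrier := ?H\<rparr>"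
  proof (rule group.normal_generateI[OF subgroup.subgroup_is_group[OF H group_axioms]])
    fix h g assume "h \<in> ?U" and "g \<in> carrier (G\<lparr>carrier := ?H\<rparr>)"
    then obtain x y where xy: "h = x \<otimes> inv y" "x \<in> S" "y \<in> S" and g: "g \<in> ?H" by auto
    have car: "x \<in> carrier G" "y \<in> carrier G" "g \<in> carrier G"
      using xy S HG[OF g] by auto
    have "g \<otimes> h \<otimes> inv g = (g \<otimes> x \<otimes> inv g) \<otimes> inv (g \<otimes> y \<otimes> inv g)"
      using car by (simp add: xy inv_mult_group m_assoc inv_mult_cancel)
    then show "g \<otimes>\<^bsub>G\<lparr>carrier := ?H\<rparr>\<^esub> h \<otimes>\<^bsub>G\<lparr>carrier := ?H\<rparr>\<^esub> inv\<^bsub>G\<lparr>carrier := ?H\<rparr>\<^esub> g \<in> ?U"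
      using conj[OF g] xy g H by auto
  qed (use UH in auto)
  then have normal: "?T \<lhd> G\<lparr>carrier := ?H\<rparr>"
    using generate_consistent[OF UH H] by simp
  have T_conj: "g \<otimes> t \<otimes> inv g \<in> ?T" if "g \<in> ?H" "t \<in> ?T" for g t
    using normal.inv_op_closed2[OF normal, of g t] that H by simp
  have "g \<otimes> h \<otimes> inv g \<otimes> inv h \<in> ?T" if "g \<in> ?H" "h \<in> ?H" for g h
    using that
  proof (induction arbitrary: h rule: generate.induct)
    case one
    then show ?case using HG T by (simp add: subgroup.one_closed)
  next
    case (incl s)
    \<comment> \<open>A commutator with a generator is itself a quotient of two elements of
      \<open>S\<close>: \<open>s\<close> and its conjugate by \<open>h\<close>.\<close>
    have "s \<otimes> h \<otimes> inv s \<otimes> inv h = s \<otimes> inv (h \<otimes> s \<otimes> inv h)"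
      using incl S HG by (auto simp: inv_mult_group m_assoc)
    then show ?case using incl conj by (intro generate.incl) auto
  next
    case (inv s)
    have car: "s \<in> carrier G" "h \<in> carrier G" using inv S HG by auto
    \<comment> \<open>The commutator of \<open>inv s\<close> and \<open>h\<close> is a quotient
      conjugated by \<open>inv s\<close>, so \<open>T_conj\<close> applies.\<close>
    have "inv s \<otimes> h \<otimes> inv (inv s) \<otimes> inv h
        = inv s \<otimes> ((h \<otimes> s \<otimes> inv h) \<otimes> inv s) \<otimes> inv (inv s)"
      using car by (simp add: m_assoc)
    moreover have "(h \<otimes> s \<otimes> inv h) \<otimes> inv s \<in> ?T"
      using inv conj by (intro generate.incl) auto
    ultimately show ?case
      using T_conj[OF generate.inv[OF inv(1)]] by simp
  next
    case (eng g1 g2)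
    have car: "g1 \<in> carrier G" "g2 \<in> carrier G" "h \<in> carrier G" using eng HG by auto
    \<comment> \<open>The identity \<open>[g1 g2, h] = (g1 [g2, h] (inv g1)) [g1, h]\<close> reduces
      a product to its factors, up to conjugation.\<close>
    have "g1 \<otimes> g2 \<otimes> h \<otimes> inv (g1 \<otimes> g2) \<otimes> inv h
        = (g1 \<otimes> (g2 \<otimes> h \<otimes> inv g2 \<otimes> inv h) \<otimes> inv g1) \<otimes> (g1 \<otimes> h \<otimes> inv g1 \<otimes> inv h)"
      using car by (simp add: inv_mult_group m_assoc inv_mult_cancel)
    then show ?case
      using eng T_conj by (simp add: generate.eng)
  qed
  then show ?thesis
    unfolding derived_def by (intro generate_subgroup_incl[OF _ T]) auto
qed

section \<open>Permutations and automorphisms of a quandle\<close>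

lemma BijGroup_mult_apply:
  "g \<in> Bij Q \<Longrightarrow> f \<in> Bij Q \<Longrightarrow> x \<in> Q \<Longrightarrow> (g \<otimes>\<^bsub>BijGroup Q\<^esub> f) x = g (f x)"
  by (simp add: BijGroup_def compose_def)

lemma BijGroup_one_apply: "x \<in> Q \<Longrightarrow> \<one>\<^bsub>BijGroup Q\<^esub> x = x"
  by (simp add: BijGroup_def)

lemma BijGroup_inv_apply:
  assumes "g \<in> Bij Q" "x \<in> Q"
  shows "(inv\<^bsub>BijGroup Q\<^esub> g) (g x) = x" "g ((inv\<^bsub>BijGroup Q\<^esub> g) x) = x"
  using assms Bij_imp_funcset[OF assms(1)]
  by (auto simp: inv_BijGroup Bij_def bij_betw_def f_inv_into_f)

lemma carrier_BijGroup: "carrier (BijGroup Q) = Bij Q"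
  by (simp add: BijGroup_def)

lemma Bij_mem: "g \<in> Bij Q \<Longrightarrow> x \<in> Q \<Longrightarrow> g x \<in> Q"
  using Bij_imp_funcset by blast

lemma Bij_eqI:
  "f \<in> Bij Q \<Longrightarrow> g \<in> Bij Q \<Longrightarrow> (\<And>x. x \<in> Q \<Longrightarrow> f x = g x) \<Longrightarrow> f = g"
  by (meson Bij_imp_extensional extensionalityI)

lemma magma_auto_subgroup:
  assumes closed: "\<And>x y. x \<in> Q \<Longrightarrow> y \<in> Q \<Longrightarrow> m x y \<in> Q"
  shows "subgroup (magma_auto Q m) (BijGroup Q)"
proof (rule group.subgroupI[OF group_BijGroup])
  show "magma_auto Q m \<subseteq> carrier (BijGroup Q)"
    by (auto simp: magma_auto_def carrier_BijGroup)
  have "(\<lambda>x\<in>Q. x) \<in> magma_auto Q m"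
    using closed id_Bij by (auto simp: magma_auto_def magma_iso_def Bij_def)
  then show "magma_auto Q m \<noteq> {}" by blast
next
  fix g assume g: "g \<in> magma_auto Q m"
  then have gB: "g \<in> Bij Q" by (simp add: magma_auto_def)
  have iB: "inv\<^bsub>BijGroup Q\<^esub> g \<in> Bij Q"
    using group.inv_closed[OF group_BijGroup] gB by (metis carrier_BijGroup)
  have "(inv\<^bsub>BijGroup Q\<^esub> g) (m x y) = m ((inv\<^bsub>BijGroup Q\<^esub> g) x) ((inv\<^bsub>BijGroup Q\<^esub> g) y)"
    if "x \<in> Q" "y \<in> Q" for x y
    using that Bij_inv_into_lemma[of Q g m x y] g gB closed
    by (auto simp: inv_BijGroup magma_auto_def magma_iso_def)
  then show "inv\<^bsub>BijGroup Q\<^esub> g \<in> magma_auto Q m"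
    using iB by (auto simp: magma_auto_def magma_iso_def Bij_def)
next
  fix g f assume gf: "g \<in> magma_auto Q m" "f \<in> magma_auto Q m"
  then have B: "g \<in> Bij Q" "f \<in> Bij Q" by (simp_all add: magma_auto_def)
  then have "g \<otimes>\<^bsub>BijGroup Q\<^esub> f \<in> Bij Q"
    using group.subgroup_self[OF group_BijGroup] subgroup.m_closed by (metis carrier_BijGroup)
  then show "g \<otimes>\<^bsub>BijGroup Q\<^esub> f \<in> magma_auto Q m"
    using gf B closed Bij_mem[OF B(2)]
    by (auto simp: magma_auto_def magma_iso_def Bij_def BijGroup_mult_apply)
qed

section \<open>Right translations, \<open>RMlt\<close> and its derived subgroup for a fixed
  quandle\<close>

locale quandle_on =
  fixes Q :: "'a set" and m :: "'a \<Rightarrow> 'a \<Rightarrow> 'a"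
  assumes quandle: "quandle Q m"
begin

abbreviation "B \<equiv> BijGroup Q"
abbreviation "R \<equiv> right_translation Q m"
abbreviation "D \<equiv> derived B (RMlt Q m)"

sublocale B: group B
  by (rule group_BijGroup)

lemma closed: "x \<in> Q \<Longrightarrow> y \<in> Q \<Longrightarrow> m x y \<in> Q"
  and idem: "x \<in> Q \<Longrightarrow> m x x = x"
  and R_auto: "x \<in> Q \<Longrightarrow> R x \<in> magma_auto Q m"
  using quandle by (auto simp: quandle_def)

lemma R_Bij: "x \<in> Q \<Longrightarrow> R x \<in> Bij Q"
  using R_auto by (simp add: magma_auto_def)

lemma R_apply: "y \<in> Q \<Longrightarrow> R x y = m y x"
  by (simp add: right_translation_def)

lemma R_carrier: "R ` Q \<subseteq> carrier B"
  using R_Bij by (auto simp: carrier_BijGroup)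

lemma RMlt_subgroup: "subgroup (RMlt Q m) B"
  unfolding RMlt_def by (rule B.generate_is_subgroup[OF R_carrier])

lemma RMlt_auto: "RMlt Q m \<subseteq> magma_auto Q m"
  unfolding RMlt_def
  by (rule B.generate_subgroup_incl[OF _ magma_auto_subgroup[OF closed]]) (auto simp: R_auto)

lemma RMlt_Bij: "g \<in> RMlt Q m \<Longrightarrow> g \<in> Bij Q"
  using RMlt_auto by (auto simp: magma_auto_def)

lemma R_RMlt: "x \<in> Q \<Longrightarrow> R x \<in> RMlt Q m"
  unfolding RMlt_def by (auto intro: generate.incl)

lemma RMlt_hom: "g \<in> RMlt Q m \<Longrightarrow> x \<in> Q \<Longrightarrow> y \<in> Q \<Longrightarrow> g (m x y) = m (g x) (g y)"
  using RMlt_auto by (auto simp: magma_auto_def magma_iso_def)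

text \<open>Evaluated at a point \<open>y\<close>, this is the homomorphism property
  \<open>g (m y x) = m (g y) (g x)\<close>.\<close>

lemma R_intertwine:
  assumes "g \<in> RMlt Q m" "x \<in> Q"
  shows "g \<otimes>\<^bsub>B\<^esub> R x = R (g x) \<otimes>\<^bsub>B\<^esub> g"
proof -
  have B: "g \<in> Bij Q" "R x \<in> Bij Q" "g x \<in> Q" "R (g x) \<in> Bij Q"
    using assms RMlt_Bij[OF assms(1)] R_Bij by (simp_all add: Bij_mem)
  show ?thesis
    using B assms Bij_mem[OF B(1)] B.m_closed[unfolded carrier_BijGroup]
    by (intro Bij_eqI[of _ Q]) (auto simp: BijGroup_mult_apply R_apply RMlt_hom)
qed

lemma R_conj:
  assumes "g \<in> RMlt Q m" "x \<in> Q"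
  shows "g \<otimes>\<^bsub>B\<^esub> R x \<otimes>\<^bsub>B\<^esub> inv\<^bsub>B\<^esub> g = R (g x)"
proof -
  have "g \<in> carrier B" "R (g x) \<in> carrier B"
    using assms RMlt_Bij[OF assms(1)] R_Bij by (simp_all add: Bij_mem carrier_BijGroup)
  then show ?thesis
    by (simp add: R_intertwine[OF assms] B.m_assoc)
qed

lemma D_subgroup: "subgroup D B"
  using B.derived_is_subgroup RMlt_subgroup subgroup.subset by blast

lemma D_RMlt: "D \<subseteq> RMlt Q m"
  by (rule B.derived_incl[OF subset_refl RMlt_subgroup])

lemma D_Bij: "d \<in> D \<Longrightarrow> d \<in> Bij Q"
  using D_RMlt RMlt_Bij by blast

lemma commutator_D:
  "g \<in> RMlt Q m \<Longrightarrow> h \<in> RMlt Q m \<Longrightarrow> g \<otimes>\<^bsub>B\<^esub> h \<otimes>\<^bsub>B\<^esub> inv\<^bsub>B\<^esub> g \<otimes>\<^bsub>B\<^esub> inv\<^bsub>B\<^esub> h \<in> D"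
  unfolding derived_def by (rule generate.incl) blast

lemma D_conj:
  assumes "g \<in> RMlt Q m" "d \<in> D"
  shows "g \<otimes>\<^bsub>B\<^esub> d \<otimes>\<^bsub>B\<^esub> inv\<^bsub>B\<^esub> g \<in> D"
proof -
  have car: "g \<in> carrier B" "d \<in> carrier B"
    using assms RMlt_Bij D_Bij by (auto simp: carrier_BijGroup)
  \<comment> \<open>The conjugate differs from \<open>d\<close> by the commutator of
    \<open>g\<close> and \<open>d\<close>.\<close>
  have "g \<otimes>\<^bsub>B\<^esub> d \<otimes>\<^bsub>B\<^esub> inv\<^bsub>B\<^esub> g = (g \<otimes>\<^bsub>B\<^esub> d \<otimes>\<^bsub>B\<^esub> inv\<^bsub>B\<^esub> g \<otimes>\<^bsub>B\<^esub> inv\<^bsub>B\<^esub> d) \<otimes>\<^bsub>B\<^esub> d"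
    using car by (simp add: B.m_assoc)
  then show ?thesis
    using commutator_D assms D_RMlt subgroup.m_closed[OF D_subgroup] by (metis subsetD)
qed

section \<open>Medial quandles\<close>

text \<open>Mediality at \<open>z\<close>, \<open>y\<close>, \<open>u\<close>, \<open>v\<close>,
  read as an equation of maps in \<open>z\<close>, gives the first identity below. Writing
  \<open>R (m u v)\<close> and \<open>R (m y v)\<close> as conjugates by \<open>R v\<close> and
  cancelling \<open>R v\<close> on the left leaves the claim.\<close>

lemma medial_R:
  assumes med: "medial Q m" and Q: "u \<in> Q" "v \<in> Q" "y \<in> Q"
  shows "R u \<otimes>\<^bsub>B\<^esub> inv\<^bsub>B\<^esub> R v \<otimes>\<^bsub>B\<^esub> R y = R y \<otimes>\<^bsub>B\<^esub> inv\<^bsub>B\<^esub> R v \<otimes>\<^bsub>B\<^esub> R u"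
proof -
  have car: "R u \<in> carrier B" "R v \<in> carrier B" "R y \<in> carrier B"
    using Q R_Bij by (auto simp: carrier_BijGroup)
  have "R (m u v) \<otimes>\<^bsub>B\<^esub> R y = R (m y v) \<otimes>\<^bsub>B\<^esub> R u"
    using Q R_Bij closed B.m_closed[unfolded carrier_BijGroup] med
    by (intro Bij_eqI[of _ Q]) (auto simp: BijGroup_mult_apply R_apply medial_def)
  moreover have "R (m x v) = R v \<otimes>\<^bsub>B\<^esub> R x \<otimes>\<^bsub>B\<^esub> inv\<^bsub>B\<^esub> R v" if "x \<in> Q" for x
    using R_conj[OF R_RMlt[OF Q(2)] that] that by (simp add: R_apply)
  ultimately show ?thesis
    using Q car by (simp add: B.m_assoc)
qed

text \<open>The reversal rule \<open>medial_R\<close> is applied twice: directly to the first three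
  factors, then in inverted form to the last three.\<close>

lemma medial_quotients_commute:
  assumes med: "medial Q m" and Q: "u \<in> Q" "v \<in> Q" "y \<in> Q" "w \<in> Q"
  shows "(R u \<otimes>\<^bsub>B\<^esub> inv\<^bsub>B\<^esub> R v) \<otimes>\<^bsub>B\<^esub> (R y \<otimes>\<^bsub>B\<^esub> inv\<^bsub>B\<^esub> R w)
       = (R y \<otimes>\<^bsub>B\<^esub> inv\<^bsub>B\<^esub> R w) \<otimes>\<^bsub>B\<^esub> (R u \<otimes>\<^bsub>B\<^esub> inv\<^bsub>B\<^esub> R v)"
proof -
  have car: "R u \<in> carrier B" "R v \<in> carrier B" "R y \<in> carrier B" "R w \<in> carrier B"
    using Q R_Bij by (auto simp: carrier_BijGroup)
  have "inv\<^bsub>B\<^esub> (R w \<otimes>\<^bsub>B\<^esub> inv\<^bsub>B\<^esub> R u \<otimes>\<^bsub>B\<^esub> R v) = inv\<^bsub>B\<^esub> (R v \<otimes>\<^bsub>B\<^esub> inv\<^bsub>B\<^esub> R u \<otimes>\<^bsub>B\<^esub> R w)"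
    using medial_R[OF med] Q by simp
  then have inv: "inv\<^bsub>B\<^esub> R v \<otimes>\<^bsub>B\<^esub> (R u \<otimes>\<^bsub>B\<^esub> inv\<^bsub>B\<^esub> R w) = inv\<^bsub>B\<^esub> R w \<otimes>\<^bsub>B\<^esub> (R u \<otimes>\<^bsub>B\<^esub> inv\<^bsub>B\<^esub> R v)"
    using car by (simp add: B.inv_mult_group)
  have "(R u \<otimes>\<^bsub>B\<^esub> inv\<^bsub>B\<^esub> R v) \<otimes>\<^bsub>B\<^esub> (R y \<otimes>\<^bsub>B\<^esub> inv\<^bsub>B\<^esub> R w)
      = (R u \<otimes>\<^bsub>B\<^esub> inv\<^bsub>B\<^esub> R v \<otimes>\<^bsub>B\<^esub> R y) \<otimes>\<^bsub>B\<^esub> inv\<^bsub>B\<^esub> R w"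
    using car by (simp add: B.m_assoc)
  also have "\<dots> = R y \<otimes>\<^bsub>B\<^esub> (inv\<^bsub>B\<^esub> R v \<otimes>\<^bsub>B\<^esub> (R u \<otimes>\<^bsub>B\<^esub> inv\<^bsub>B\<^esub> R w))"
    unfolding medial_R[OF med Q(1,2,3)] using car by (simp add: B.m_assoc)
  also have "\<dots> = (R y \<otimes>\<^bsub>B\<^esub> inv\<^bsub>B\<^esub> R w) \<otimes>\<^bsub>B\<^esub> (R u \<otimes>\<^bsub>B\<^esub> inv\<^bsub>B\<^esub> R v)"
    unfolding inv using car by (simp add: B.m_assoc)
  finally show ?thesis .
qed

lemma medial_imp_derived_comm:
  assumes "medial Q m"
  shows "comm_group (B\<lparr>carrier := D\<rparr>)"
proof -
  let ?U = "{x \<otimes>\<^bsub>B\<^esub> inv\<^bsub>B\<^esub> y | x y. x \<in> R ` Q \<and> y \<in> R ` Q}"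
  have "D \<subseteq> generate B ?U"
    unfolding RMlt_def
  proof (rule B.derived_generate_subset[OF R_carrier])
    fix g s assume "g \<in> generate B (R ` Q)" "s \<in> R ` Q"
    then obtain x where "x \<in> Q" "s = R x" and g: "g \<in> RMlt Q m" by (auto simp: RMlt_def)
    then show "g \<otimes>\<^bsub>B\<^esub> s \<otimes>\<^bsub>B\<^esub> inv\<^bsub>B\<^esub> g \<in> R ` Q"
      using R_conj Bij_mem[OF RMlt_Bij[OF g]] by auto
  qed
  moreover have "a \<otimes>\<^bsub>B\<^esub> b = b \<otimes>\<^bsub>B\<^esub> a" if "a \<in> generate B ?U" "b \<in> generate B ?U" for a b
  proof (rule B.generate_commute[OF _ _ that])
    show "?U \<subseteq> carrier B" using R_carrier by auto
  qed (use medial_quotients_commute[OF assms] in auto)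
  ultimately show ?thesis
    by (intro group.group_comm_groupI[OF subgroup.subgroup_is_group[OF D_subgroup B.group_axioms]])
       (simp add: subset_iff)
qed

section \<open>Affine quandles\<close>

text \<open>In additive notation, both sides of the medial law in \<open>A\<close> equal
  \<open>f (f x) + f (1 - f) (y + u) + (1 - f) (1 - f) v\<close>, which is symmetric in
  \<open>y\<close> and \<open>u\<close>; the law is then carried over along
  \<open>h\<close>.\<close>

lemma affine_imp_medial:
  assumes "affine_quandle Q m"
  shows "medial Q m"
proof -
  obtain A :: "'a monoid" and f h where A: "comm_group A" and f: "f \<in> auto A"
    and h: "h \<in> magma_iso (carrier A) (aff_op A f) Q m"
    using assms unfolding affine_quandle_def by blast
  interpret A: comm_group A by fact
  have hom: "f \<in> hom A A" using f by (simp add: auto_def)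
  interpret f: group_hom A A f by unfold_locales (fact hom)
  have op_closed: "aff_op A f x y \<in> carrier A" if "x \<in> carrier A" "y \<in> carrier A" for x y
    using that by (simp add: aff_op_def)
  have surj: "h ` carrier A = Q"
    and op: "\<And>x y. x \<in> carrier A \<Longrightarrow> y \<in> carrier A \<Longrightarrow> m (h x) (h y) = h (aff_op A f x y)"
    using h by (auto simp: magma_iso_def bij_betw_def)
  have "aff_op A f (aff_op A f x y) (aff_op A f u v)
      = aff_op A f (aff_op A f x u) (aff_op A f y v)"
    if "x \<in> carrier A" "y \<in> carrier A" "u \<in> carrier A" "v \<in> carrier A" for x y u v
    using that by (simp add: aff_op_def A.inv_mult A.m_ac)
  then show ?thesis
    unfolding medial_def surj[symmetric] by (simp add: op op_closed)
qed

lemma translations_imp_affine: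
  fixes A :: "'a monoid"
  assumes A: "comm_group A" and car: "carrier A = Q"
    and Mlt: "Mlt_grp A \<subseteq> RMlt Q m" and Aff: "RMlt Q m \<subseteq> Aff_grp A"
  shows "affine_quandle Q m"
proof -
  interpret A: comm_group A by fact
  have one: "\<one>\<^bsub>A\<^esub> \<in> Q" using car by auto
  \<comment> \<open>The automorphism is the linear part of the right translation by the identity of
    \<open>A\<close>.\<close>
  obtain c f where c: "c \<in> carrier A" and f: "f \<in> auto A"
    and R1: "R \<one>\<^bsub>A\<^esub> = (\<lambda>x\<in>carrier A. c \<otimes>\<^bsub>A\<^esub> f x)"
    using Aff R_RMlt[OF one] by (auto simp: Aff_grp_def)
  have hom: "f \<in> hom A A" using f by (simp add: auto_def)
  interpret f: group_hom A A f by unfold_locales (fact hom)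
  \<comment> \<open>By idempotence this right translation fixes the identity of \<open>A\<close>,
    which the affine map sends to \<open>c\<close>.\<close>
  have "c = \<one>\<^bsub>A\<^esub>"
    using fun_cong[OF R1, of "\<one>\<^bsub>A\<^esub>"] c one by (simp add: R_apply idem)
  then have m1: "m x \<one>\<^bsub>A\<^esub> = f x" if "x \<in> Q" for x
    using fun_cong[OF R1, of x] that f.hom_closed[of x] car by (simp add: R_apply)
  have "m x y = aff_op A f x y" if "x \<in> Q" "y \<in> Q" for x y
  proof -
    have xy: "x \<in> carrier A" "y \<in> carrier A" using that car by auto
    let ?t = "\<lambda>x\<in>carrier A. y \<otimes>\<^bsub>A\<^esub> x"
    have t: "?t \<in> RMlt Q m" using Mlt xy by (auto simp: Mlt_grp_def)
    let ?z = "inv\<^bsub>A\<^esub> y \<otimes>\<^bsub>A\<^esub> x"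
    have z: "?z \<in> Q" using xy car by auto
    \<comment> \<open>Translation by \<open>y\<close> is an automorphism of \<open>Q\<close> and
      carries the pair \<open>?z\<close>, identity to \<open>x\<close>, \<open>y\<close>; this
      reduces every product to one by the identity.\<close>
    have "m (?t ?z) (?t \<one>\<^bsub>A\<^esub>) = ?t (m ?z \<one>\<^bsub>A\<^esub>)"
      using RMlt_hom[OF t z one] by simp
    moreover have "?t ?z = x"
      using xy by (simp add: A.m_assoc[symmetric])
    ultimately have "m x y = y \<otimes>\<^bsub>A\<^esub> f ?z"
      using xy z by (simp add: m1)
    also have "\<dots> = aff_op A f x y"
      using xy by (simp add: aff_op_def A.m_ac)
    finally show ?thesis .
  qed
  then have "(\<lambda>x. x) \<in> magma_iso (carrier A) (aff_op A f) Q m"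
    using car by (auto simp: magma_iso_def bij_betw_def)
  then show ?thesis using A f unfolding affine_quandle_def by blast
qed

end

section \<open>The derived subgroup of a connected quandle\<close>

locale connected_quandle_on = quandle_on +
  assumes connected: "connected_quandle Q m"
begin

lemma RMlt_transitive: "x \<in> Q \<Longrightarrow> y \<in> Q \<Longrightarrow> \<exists>g\<in>RMlt Q m. g x = y"
  using connected transitive_action.unique_orbit
  unfolding connected_quandle_def by fastforce

text \<open>The stabilizing map \<open>R e\<close> can be divided out: a generator
  \<open>R x\<close> agrees at \<open>e\<close> with \<open>R x\<close> times the inverse of
  \<open>R e\<close>, which is a commutator because \<open>R x\<close> is conjugate to
  \<open>R e\<close>.\<close>

lemma RMlt_orbit_D:
  assumes e: "e \<in> Q" and g: "g \<in> RMlt Q m"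
  shows "\<exists>d\<in>D. g e = d e"
  using g unfolding RMlt_def
proof (induction rule: generate.induct)
  case one
  then show ?case
    using subgroup.one_closed[OF D_subgroup] unfolding RMlt_def by blast
next
  case (incl s)
  then obtain x where x: "x \<in> Q" "s = R x" by auto
  obtain h where h: "h \<in> RMlt Q m" "h e = x" using RMlt_transitive[OF e x(1)] by blast
  have Re: "R e \<in> RMlt Q m" "R e e = e" "R e \<in> Bij Q" "R x \<in> Bij Q"
    using e x R_RMlt R_Bij by (auto simp: R_apply idem)
  let ?d = "h \<otimes>\<^bsub>B\<^esub> R e \<otimes>\<^bsub>B\<^esub> inv\<^bsub>B\<^esub> h \<otimes>\<^bsub>B\<^esub> inv\<^bsub>B\<^esub> R e"
  have "?d = R x \<otimes>\<^bsub>B\<^esub> inv\<^bsub>B\<^esub> R e" using R_conj[OF h(1) e] h(2) by simp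
  \<comment> \<open>The argument is written as \<open>R e e\<close> instead of \<open>e\<close> so
    that the inverse of \<open>R e\<close> cancels.\<close>
  then have "?d (R e e) = R x e"
    using Re e B.inv_closed[unfolded carrier_BijGroup] BijGroup_inv_apply(1)[OF Re(3) e]
    by (simp add: BijGroup_mult_apply)
  then show ?case
    using commutator_D[OF h(1) Re(1)] Re(2) x unfolding RMlt_def by metis
next
  case (inv s)
  then obtain x where x: "x \<in> Q" "s = R x" by auto
  obtain h where h: "h \<in> RMlt Q m" "h e = x" using RMlt_transitive[OF e x(1)] by blast
  have Re: "R e \<in> RMlt Q m" "R e e = e" "R e \<in> Bij Q" "R x \<in> Bij Q"
    using e x R_RMlt R_Bij by (auto simp: R_apply idem)
  have iRe: "inv\<^bsub>B\<^esub> R e \<in> RMlt Q m"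
    using subgroup.m_inv_closed[OF RMlt_subgroup] Re by blast
  have car: "h \<in> carrier B" "R e \<in> carrier B"
    using h Re RMlt_Bij by (auto simp: carrier_BijGroup)
  \<comment> \<open>The same commutator with \<open>R e\<close> replaced by its inverse, which also
    fixes \<open>e\<close>.\<close>
  let ?d = "h \<otimes>\<^bsub>B\<^esub> inv\<^bsub>B\<^esub> R e \<otimes>\<^bsub>B\<^esub> inv\<^bsub>B\<^esub> h \<otimes>\<^bsub>B\<^esub> inv\<^bsub>B\<^esub> (inv\<^bsub>B\<^esub> R e)"
  have "inv\<^bsub>B\<^esub> R x = inv\<^bsub>B\<^esub> (h \<otimes>\<^bsub>B\<^esub> R e \<otimes>\<^bsub>B\<^esub> inv\<^bsub>B\<^esub> h)"
    using R_conj[OF h(1) e] h(2) by simp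
  also have "\<dots> = h \<otimes>\<^bsub>B\<^esub> inv\<^bsub>B\<^esub> R e \<otimes>\<^bsub>B\<^esub> inv\<^bsub>B\<^esub> h"
    using car by (simp add: B.inv_mult_group B.m_assoc)
  finally have "?d = inv\<^bsub>B\<^esub> R x \<otimes>\<^bsub>B\<^esub> R e" using car by simp
  then have "?d e = (inv\<^bsub>B\<^esub> R x) e"
    using Re e B.inv_closed[unfolded carrier_BijGroup] by (simp add: BijGroup_mult_apply)
  then show ?case
    using commutator_D[OF h(1) iRe] x unfolding RMlt_def by metis
next
  case (eng g1 g2)
  then obtain d1 d2 where d: "d1 \<in> D" "g1 e = d1 e" "d2 \<in> D" "g2 e = d2 e"
    unfolding RMlt_def by blast
  have g: "g1 \<in> RMlt Q m" "g2 \<in> RMlt Q m" using eng by (simp_all add: RMlt_def)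
  \<comment> \<open>Normality of \<open>D\<close> moves \<open>d2\<close> to the left past
    \<open>g1\<close>, after which \<open>g1 e\<close> can be replaced by
    \<open>d1 e\<close>.\<close>
  let ?c = "g1 \<otimes>\<^bsub>B\<^esub> d2 \<otimes>\<^bsub>B\<^esub> inv\<^bsub>B\<^esub> g1"
  have bij: "g1 \<in> Bij Q" "g2 \<in> Bij Q" "d1 \<in> Bij Q" "d2 \<in> Bij Q" "?c \<in> Bij Q" "inv\<^bsub>B\<^esub> g1 \<in> Bij Q"
    using g d RMlt_Bij D_Bij D_conj B.inv_closed[unfolded carrier_BijGroup] by auto
  have "(g1 \<otimes>\<^bsub>B\<^esub> g2) e = g1 (d2 e)"
    using bij e d by (simp add: BijGroup_mult_apply)
  also have "\<dots> = (g1 \<otimes>\<^bsub>B\<^esub> d2) e"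
    using bij e by (simp add: BijGroup_mult_apply)
  also have "g1 \<otimes>\<^bsub>B\<^esub> d2 = ?c \<otimes>\<^bsub>B\<^esub> g1"
    using bij(1,4)[folded carrier_BijGroup] by (simp add: B.m_assoc)
  also have "(?c \<otimes>\<^bsub>B\<^esub> g1) e = ?c (d1 e)"
    using bij(1,5) e d by (simp add: BijGroup_mult_apply)
  also have "\<dots> = (?c \<otimes>\<^bsub>B\<^esub> d1) e"
    using bij(3,5) e by (simp add: BijGroup_mult_apply)
  finally show ?case
    using subgroup.m_closed[OF D_subgroup D_conj[OF g(1) d(3)] d(1)] unfolding RMlt_def by metis
qed

lemma D_transitive: "x \<in> Q \<Longrightarrow> y \<in> Q \<Longrightarrow> \<exists>d\<in>D. d x = y"
  using RMlt_transitive RMlt_orbit_D by metis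

text \<open>Regularity of \<open>D\<close> identifies it with \<open>Q\<close> by evaluation at a
  base point \<open>e\<close>. Translations then become the elements of \<open>D\<close>, and
  conjugation by \<open>g\<close> in \<open>RMlt Q m\<close> becomes the linear part of
  \<open>g\<close>.\<close>

lemma derived_comm_imp_translations:
  assumes D_comm_group: "comm_group (B\<lparr>carrier := D\<rparr>)"
  shows "\<exists>A :: 'a monoid. comm_group A \<and> carrier A = Q \<and>
    Mlt_grp A \<subseteq> RMlt Q m \<and> RMlt Q m \<subseteq> Aff_grp A"
proof -
  obtain e where e: "e \<in> Q" using quandle by (auto simp: quandle_def)
  \<comment> \<open>\<open>d x\<close> is to be the element of \<open>D\<close> taking
    \<open>e\<close> to \<open>x\<close>; transitivity gives existence, and \<open>D_unique\<close>
    below shows that the choice is forced.\<close>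
  define d where "d x = (SOME g. g \<in> D \<and> g e = x)" for x
  have dD: "d x \<in> D" and de: "d x e = x" if "x \<in> Q" for x
  proof -
    have "\<exists>g. g \<in> D \<and> g e = x" using D_transitive[OF e that] by blast
    from someI_ex[OF this] show "d x \<in> D" "d x e = x" by (simp_all add: d_def)
  qed
  have D_comm: "a \<otimes>\<^bsub>B\<^esub> b = b \<otimes>\<^bsub>B\<^esub> a" if "a \<in> D" "b \<in> D" for a b
    using comm_groupE(4)[OF D_comm_group] that by simp
  have D_comm_apply: "a (b x) = b (a x)" if "a \<in> D" "b \<in> D" "x \<in> Q" for a b x
    using D_comm[OF that(1,2)] that D_Bij BijGroup_mult_apply by metis
  have D_mem: "a x \<in> Q" if "a \<in> D" "x \<in> Q" for a x
    using that D_Bij Bij_mem by metis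
  \<comment> \<open>A transitive abelian permutation group is regular: elements agreeing at
    \<open>e\<close> agree at \<open>y = d y e\<close>, since they commute with
    \<open>d y\<close>.\<close>
  have D_unique: "a = d (a e)" if a: "a \<in> D" for a
  proof (rule Bij_eqI[of _ Q])
    have aQ: "a e \<in> Q" using D_mem[OF a e] .
    show "a \<in> Bij Q" "d (a e) \<in> Bij Q" using a dD[OF aQ] D_Bij by auto
    fix y assume y: "y \<in> Q"
    have "a (d y e) = d y (d (a e) e)"
      using D_comm_apply[OF a dD[OF y] e] de[OF aQ] by simp
    also have "\<dots> = d (a e) (d y e)"
      using D_comm_apply[OF dD[OF y] dD[OF aQ] e] .
    finally show "a y = d (a e) y" using de[OF y] by simp
  qed
  have d_mult: "d (d x y) = d x \<otimes>\<^bsub>B\<^esub> d y" if "x \<in> Q" "y \<in> Q" for x y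
    using D_unique[OF subgroup.m_closed[OF D_subgroup dD dD], of x y] that e dD de D_Bij
    by (simp add: BijGroup_mult_apply)
  have d_one: "d e = \<one>\<^bsub>B\<^esub>"
    using D_unique[OF subgroup.one_closed[OF D_subgroup]] e by (simp add: BijGroup_one_apply)
  \<comment> \<open>The product \<open>d x y\<close> is the value at \<open>e\<close> of the
    composite of \<open>d x\<close> and \<open>d y\<close>, so \<open>A\<close> is \<open>D\<close>
    transported to \<open>Q\<close>.\<close>
  define A where "A = \<lparr>carrier = Q, monoid.mult = d, one = e\<rparr>"
  have A_simps: "carrier A = Q" "\<And>x y. x \<otimes>\<^bsub>A\<^esub> y = d x y" "\<one>\<^bsub>A\<^esub> = e"
    by (simp_all add: A_def)
  have A: "comm_group A"
  proof (rule comm_groupI)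
    fix x assume "x \<in> carrier A"
    then have x: "x \<in> Q" by (simp add: A_simps)
    have i: "inv\<^bsub>B\<^esub> d x \<in> D" using subgroup.m_inv_closed[OF D_subgroup dD[OF x]] .
    have "d ((inv\<^bsub>B\<^esub> d x) e) x = (inv\<^bsub>B\<^esub> d x) (d x e)"
      using D_unique[OF i] de[OF x] by simp
    also have "\<dots> = e"
      using BijGroup_inv_apply(1)[OF D_Bij[OF dD[OF x]] e] .
    finally show "\<exists>y\<in>carrier A. y \<otimes>\<^bsub>A\<^esub> x = \<one>\<^bsub>A\<^esub>"
      using D_mem[OF i e] by (auto simp: A_simps)
  next
    fix x y assume "x \<in> carrier A" "y \<in> carrier A"
    then have xy: "x \<in> Q" "y \<in> Q" by (simp_all add: A_simps)
    then show "x \<otimes>\<^bsub>A\<^esub> y = y \<otimes>\<^bsub>A\<^esub> x"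
      using D_comm_apply[OF dD dD e, of x y] by (simp add: A_simps de)
  qed (auto simp: A_simps D_mem dD d_mult d_one e BijGroup_mult_apply BijGroup_one_apply D_Bij)
  have "Mlt_grp A \<subseteq> RMlt Q m"
  proof
    fix g assume "g \<in> Mlt_grp A"
    then obtain c where c: "c \<in> Q" and g: "g = (\<lambda>x\<in>Q. d c x)"
      by (auto simp: Mlt_grp_def A_simps)
    have "g = d c"
      unfolding g by (rule extensional_restrict[OF Bij_imp_extensional[OF D_Bij[OF dD[OF c]]]])
    then show "g \<in> RMlt Q m" using dD[OF c] D_RMlt by auto
  qed
  moreover have "RMlt Q m \<subseteq> Aff_grp A"
  proof
    fix g assume g: "g \<in> RMlt Q m"
    have gB: "g \<in> Bij Q" using RMlt_Bij[OF g] .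
    define c where "c = g e"
    have c: "c \<in> Q" using Bij_mem[OF gB e] by (simp add: c_def)
    \<comment> \<open>Removing the translation that takes \<open>e\<close> to \<open>g e\<close>
      leaves a map fixing \<open>e\<close>, the candidate for the linear part.\<close>
    define f where "f = inv\<^bsub>B\<^esub> d c \<otimes>\<^bsub>B\<^esub> g"
    have icD: "inv\<^bsub>B\<^esub> d c \<in> D"
      using subgroup.m_inv_closed[OF D_subgroup dD[OF c]] .
    have fB: "f \<in> Bij Q"
      using B.m_closed[unfolded carrier_BijGroup] D_Bij[OF icD] gB by (simp add: f_def)
    have f_apply: "f x = (inv\<^bsub>B\<^esub> d c) (g x)" if "x \<in> Q" for x
      using that D_Bij[OF icD] gB by (simp add: f_def BijGroup_mult_apply)
    \<comment> \<open>Conjugation by \<open>g\<close> preserves \<open>D\<close>; \<open>f_k\<close>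
      shows that \<open>f\<close> is this conjugation seen through evaluation at
      \<open>e\<close>.\<close>
    define k where "k x = g \<otimes>\<^bsub>B\<^esub> d x \<otimes>\<^bsub>B\<^esub> inv\<^bsub>B\<^esub> g" for x
    have kD: "k x \<in> D" if "x \<in> Q" for x
      unfolding k_def by (rule D_conj[OF g dD[OF that]])
    have f_k: "f x = k x e" if x: "x \<in> Q" for x
    proof -
      have dx: "d x \<in> Bij Q" using D_Bij[OF dD[OF x]] .
      have "k x \<otimes>\<^bsub>B\<^esub> g = g \<otimes>\<^bsub>B\<^esub> d x"
        using gB[folded carrier_BijGroup] dx[folded carrier_BijGroup]
        by (simp add: k_def B.m_assoc)
      then have "k x (g e) = g (d x e)"
        using BijGroup_mult_apply[OF D_Bij[OF kD[OF x]] gB e] BijGroup_mult_apply[OF gB dx e]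
        by simp
      then have "g x = k x (d c e)"
        using de[OF x] de[OF c] by (simp add: c_def)
      also have "\<dots> = d c (k x e)"
        by (rule D_comm_apply[OF kD[OF x] dD[OF c] e])
      finally show ?thesis
        using f_apply[OF x] BijGroup_inv_apply(1)[OF D_Bij[OF dD[OF c]] D_mem[OF kD[OF x] e]]
        by simp
    qed
    have "f (d x y) = d (f x) (f y)" if x: "x \<in> Q" and y: "y \<in> Q" for x y
    proof -
      \<comment> \<open>Conjugation is multiplicative, so \<open>f\<close> inherits additivity;
        \<open>D_unique\<close> then identifies \<open>k x\<close> with
        \<open>d (f x)\<close>.\<close>
      have "k (d x y) = k x \<otimes>\<^bsub>B\<^esub> k y"
        using gB[folded carrier_BijGroup]
          D_Bij[OF dD[OF x], folded carrier_BijGroup] D_Bij[OF dD[OF y], folded carrier_BijGroup]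
        by (simp add: d_mult[OF x y] k_def B.m_assoc B.inv_mult_cancel)
      then have "f (d x y) = k x (k y e)"
        using f_k[OF D_mem[OF dD[OF x] y]]
          BijGroup_mult_apply[OF D_Bij[OF kD[OF x]] D_Bij[OF kD[OF y]] e] by simp
      also have "\<dots> = d (f x) (f y)"
        using f_k[OF x] f_k[OF y] D_unique[OF kD[OF x]] by simp
      finally show ?thesis .
    qed
    then have f: "f \<in> auto A"
      using fB Bij_mem[OF fB] by (auto simp: auto_def hom_def A_simps)
    have "g = (\<lambda>x\<in>carrier A. c \<otimes>\<^bsub>A\<^esub> f x)"
    proof (rule extensionalityI[of _ Q])
      fix x assume x: "x \<in> Q"
      show "g x = (\<lambda>x\<in>carrier A. c \<otimes>\<^bsub>A\<^esub> f x) x"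
        using x f_apply[OF x] BijGroup_inv_apply(2)[OF D_Bij[OF dD[OF c]] Bij_mem[OF gB x]]
        by (simp add: A_simps)
    qed (use gB in \<open>auto simp: A_simps Bij_imp_extensional\<close>)
    then show "g \<in> Aff_grp A"
      using f c by (auto simp: Aff_grp_def A_simps)
  qed
  ultimately show ?thesis using A A_simps(1) by blast
qed

end

theorem theorem7p3:
  fixes Q :: "'a set" and m :: "'a \<Rightarrow> 'a \<Rightarrow> 'a"
  assumes "connected_quandle Q m"
  shows "(affine_quandle Q m \<longleftrightarrow> medial Q m) \<and>
    (medial Q m \<longleftrightarrow>
       comm_group (BijGroup Q\<lparr>carrier := derived (BijGroup Q) (RMlt Q m)\<rparr>)) \<and>
    (comm_group (BijGroup Q\<lparr>carrier := derived (BijGroup Q) (RMlt Q m)\<rparr>) \<longleftrightarrow>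
       (\<exists>A :: 'a monoid. comm_group A \<and> carrier A = Q \<and>
          Mlt_grp A \<subseteq> RMlt Q m \<and> RMlt Q m \<subseteq> Aff_grp A))"
proof -
  interpret connected_quandle_on Q m
    using assms by unfold_locales (simp_all add: connected_quandle_def)
  show ?thesis
    \<comment> \<open>These four facts close the cycle from affine through medial, abelian derived
      subgroup and translations back to affine.\<close>
    using affine_imp_medial medial_imp_derived_comm derived_comm_imp_translations
      translations_imp_affine by blast
qed

end
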